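(* For any $d\in\mathbb{N}$, $\varepsilon>0$, and a large enough integer $k$, there exists a set function $f:2^{[m]}\to\mathbb{R}_{\ge0}$ with $\mathrm{SMW}(f)=d$ such that any (possibly randomized) algorithm that produces a $(1/(d+1)+\varepsilon)$-approximation (with a constant probability, if randomized) for the $k$-constrained maximization problem makes at least $\Omega\left((m/2k)^{k^{0.99}}\right)$ value queries.
   Context: Set functions are normalized ($f(\emptyset)=0$) and monotone ($f(S)\le f(T)$ for $S\subseteq T$), accessed via a value oracle returning $f(S)$ for a queried $S$. Write $f(v\mid T)=f(T\cup\{v\})-f(T)$. A set $T$ is supermodular w.r.t. $f$ if there exist $S\subseteq[m]$ and $v\in[m]\setminus T$ with $f(v\mid S\cup T)>\max_{T'\subsetneq T} f(v\mid S\cup T')$; $\mathrm{SMW}(f)$ is the maximum cardinality of a nonempty supermodular set (0 if none). The $k$-constrained maximization problem asks for $S\subseteq[m]$ with $|S|\le k$ maximizing $f(S)$; an $\alpha$-approximation is a feasible set of value at least $\alpha$ times the optimum.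
   Formalization: The algorithm must succeed on every monotone normalized function with SMW = d (for one fixed f it could hard-wire the optimum), queries being counted on f; and m, unquantified in the statement, is at least M·k with M depending only on d, ε and the success probability (for m ≤ k the bound fails). *)

theory Defs
  imports "HOL-Probability.Probability"
begin

text \<open>Set functions on the ground set \<open>[m] = {1..m}\<close> are represented by functions on
  \<^typ>\<open>nat set\<close>; only their values on subsets of \<open>{1..m}\<close> are ever used.\<close>

definition set_function :: "nat \<Rightarrow> (nat set \<Rightarrow> real) \<Rightarrow> bool" where
  "set_function m f \<longleftrightarrow>
     f {} = 0 \<and>
     (\<forall>S \<subseteq> {1..m}. 0 \<le> f S) \<and>
     (\<forall>S T. S \<subseteq> T \<and> T \<subseteq> {1..m} \<longrightarrow> f S \<le> f T)"

definition marginal :: "(nat set \<Rightarrow> real) \<Rightarrow> nat \<Rightarrow> nat set \<Rightarrow> real" where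
  "marginal f v T = f (T \<union> {v}) - f T"

text \<open>Only meaningful for nonempty \<open>T\<close>: for \<open>T = {}\<close> the maximum is over the empty set.\<close>

definition supermodular_set :: "nat \<Rightarrow> (nat set \<Rightarrow> real) \<Rightarrow> nat set \<Rightarrow> bool" where
  "supermodular_set m f T \<longleftrightarrow>
     T \<subseteq> {1..m} \<and>
     (\<exists>S v. S \<subseteq> {1..m} \<and> v \<in> {1..m} - T \<and>
        marginal f v (S \<union> T) > Max {marginal f v (S \<union> T') |T'. T' \<subset> T})"

definition SMW :: "nat \<Rightarrow> (nat set \<Rightarrow> real) \<Rightarrow> nat" where
  "SMW m f = Max (insert 0 (card ` {T. T \<noteq> {} \<and> supermodular_set m f T}))"

definition feasible :: "nat \<Rightarrow> nat \<Rightarrow> nat set \<Rightarrow> bool" where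
  "feasible m k S \<longleftrightarrow> S \<subseteq> {1..m} \<and> card S \<le> k"

definition approximates :: "nat \<Rightarrow> nat \<Rightarrow> real \<Rightarrow> (nat set \<Rightarrow> real) \<Rightarrow> nat set \<Rightarrow> bool" where
  "approximates m k \<alpha> f S \<longleftrightarrow>
     feasible m k S \<and> f S \<ge> \<alpha> * Max {f S' |S'. feasible m k S'}"

text \<open>A deterministic adaptive value-query algorithm maps the list of oracle answers received so
  far to its next action. There is no bound on its computing power, and it need not halt.\<close>

datatype action = Query "nat set" | Output "nat set"

type_synonym algorithm = "real list \<Rightarrow> action"

definition algorithm_on :: "nat \<Rightarrow> algorithm \<Rightarrow> bool" where
  "algorithm_on m A \<longleftrightarrow> (\<forall>h S. A h = Query S \<or> A h = Output S \<longrightarrow> S \<subseteq> {1..m})"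

text \<open>The answers received in the first \<open>n\<close> steps; the list stops growing once the algorithm
  outputs a set.\<close>

primrec answers :: "algorithm \<Rightarrow> (nat set \<Rightarrow> real) \<Rightarrow> nat \<Rightarrow> real list" where
  "answers A f 0 = []"
| "answers A f (Suc n) =
     (case A (answers A f n) of
        Query S \<Rightarrow> answers A f n @ [f S]
      | Output S \<Rightarrow> answers A f n)"

definition outputs :: "algorithm \<Rightarrow> (nat set \<Rightarrow> real) \<Rightarrow> nat set \<Rightarrow> bool" where
  "outputs A f S \<longleftrightarrow> (\<exists>n. A (answers A f n) = Output S)"

text \<open>The index of the first output action, which is the number of queries preceding it. The
  infimum of the empty set is \<open>\<infinity>\<close>, the number of queries of a run that does not halt.\<close>

definition num_queries :: "algorithm \<Rightarrow> (nat set \<Rightarrow> real) \<Rightarrow> enat" where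
  "num_queries A f = Inf {enat n |n. \<exists>S. A (answers A f n) = Output S}"

definition succeeds :: "nat \<Rightarrow> nat \<Rightarrow> real \<Rightarrow> (nat set \<Rightarrow> real) \<Rightarrow> algorithm \<Rightarrow> bool" where
  "succeeds m k \<alpha> f A \<longleftrightarrow> (\<exists>S. outputs A f S \<and> approximates m k \<alpha> f S)"

text \<open>A randomized algorithm is a probability distribution over deterministic ones, on any
  sigma-algebra for which the output and the number of queries are random variables.\<close>

definition randomized_algorithm_on :: "nat \<Rightarrow> algorithm measure \<Rightarrow> bool" where
  "randomized_algorithm_on m R \<longleftrightarrow>
     prob_space R \<and>
     (\<forall>A \<in> space R. algorithm_on m A) \<and>
     (\<forall>f. set_function m f \<longrightarrow>
        (\<forall>S. {A \<in> space R. outputs A f S} \<in> sets R) \<and>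
        (\<lambda>A. num_queries A f) \<in> measurable R (count_space UNIV))"

definition approximation_algorithm :: "nat \<Rightarrow> nat \<Rightarrow> nat \<Rightarrow> real \<Rightarrow> algorithm \<Rightarrow> bool" where
  "approximation_algorithm m k d \<alpha> A \<longleftrightarrow>
     algorithm_on m A \<and>
     (\<forall>g. set_function m g \<and> SMW m g = d \<longrightarrow> succeeds m k \<alpha> g A)"

definition randomized_approximation_algorithm ::
    "nat \<Rightarrow> nat \<Rightarrow> nat \<Rightarrow> real \<Rightarrow> real \<Rightarrow> algorithm measure \<Rightarrow> bool" where
  "randomized_approximation_algorithm m k d \<alpha> p R \<longleftrightarrow>
     randomized_algorithm_on m R \<and>
     (\<forall>g. set_function m g \<and> SMW m g = d \<longrightarrow>
        measure R {A \<in> space R. succeeds m k \<alpha> g A} \<ge> p)"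

definition expected_queries :: "algorithm measure \<Rightarrow> (nat set \<Rightarrow> real) \<Rightarrow> ennreal" where
  "expected_queries R f = (\<integral>\<^sup>+ A. ennreal_of_enat (num_queries A f) \<partial>R)"

end

theory Submission
  imports Defs
begin

text \<open>
  Let \<open>f S = min k (|S| div (d + 1))\<close>, where only every \<open>(d + 1)\<close>-st element brings a gain. For a
  hidden \<open>k\<close>-set \<open>H\<close>, let all elements of \<open>H\<close> after the first \<open>t\<close> bring a gain of 1 each. Both
  functions have supermodular width \<open>d\<close>, since in any run of \<open>d + 1\<close> additions that matter some
  position already has the largest possible marginal. The optimum is at most \<open>k / (d + 1)\<close> for \<open>f\<close>
  but at least \<open>k - t\<close> for the planted function. The two differ only on sets \<open>S\<close> with
  \<open>|S| < (d + 1) k\<close> and \<open>|S \<inter> H| > t\<close>; for \<open>t\<close> a small constant fraction of \<open>k\<close>, a fixed \<open>S\<close> has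
  this property with probability at most \<open>2 ^ ((d + 2) k) (k / m) ^ t\<close> over a uniformly random \<open>H\<close>.
  An algorithm that succeeds on every planted function must, when run on \<open>f\<close>, hit such a set with
  a query or its output, so a union bound over the run on \<open>f\<close> gives the lower bound.
\<close>

section \<open>Planted set functions\<close>

text \<open>The elements that gain only in blocks of \<open>d + 1\<close>: those outside
  \<open>H\<close>, and the first \<open>t\<close> of \<open>H\<close> in any order of
  insertion.\<close>

definition charge :: "nat \<Rightarrow> nat set \<Rightarrow> nat set \<Rightarrow> nat" where
  "charge t H S = card (S - H) + min (card (S \<inter> H)) t"

definition uncapped :: "nat \<Rightarrow> nat \<Rightarrow> nat set \<Rightarrow> nat set \<Rightarrow> nat" where
  "uncapped d t H S = charge t H S div (d + 1) + (card (S \<inter> H) - t)"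

text \<open>The cap at \<open>k\<close> hides \<open>H\<close> from large queries: every set of at
  least \<open>(d + 1) * k\<close> elements has value \<open>k\<close> whatever \<open>H\<close> is.
  \<open>H = {}\<close> gives the unplanted function.\<close>

definition planted :: "nat \<Rightarrow> nat \<Rightarrow> nat \<Rightarrow> nat set \<Rightarrow> nat set \<Rightarrow> real" where
  "planted d k t H S = real (min k (uncapped d t H S))"

text \<open>Describes the marginal apart from the cap, so that the width argument reduces to
  residues of \<open>charge\<close> modulo \<open>d + 1\<close>.\<close>

definition gains :: "nat \<Rightarrow> nat \<Rightarrow> nat set \<Rightarrow> nat \<Rightarrow> nat set \<Rightarrow> bool" where
  "gains d t H v U \<longleftrightarrow> v \<in> H \<and> t \<le> card (U \<inter> H) \<or> charge t H U mod (d + 1) = d"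

text \<open>A hidden \<open>v\<close> after the first \<open>t\<close> leaves \<open>charge\<close>
  alone and gains directly; any other new \<open>v\<close> raises \<open>charge\<close> by one, and
  the quotient grows exactly when this completes a block.\<close>

lemma uncapped_insert:
  assumes "finite U" "v \<notin> U"
  shows "uncapped d t H (insert v U) = uncapped d t H U + (if gains d t H v U then 1 else 0)"
proof -
  have step: "(n + 1) div (d + 1) = n div (d + 1) + (if n mod (d + 1) = d then 1 else 0)" for n :: nat
    by (simp add: div_Suc mod_Suc)
  show ?thesis
  proof (cases "v \<in> H")
    case True
    have i: "insert v U - H = U - H" "insert v U \<inter> H = insert v (U \<inter> H)" using True by auto
    have c: "card (insert v (U \<inter> H)) = card (U \<inter> H) + 1" using assms by simp
    show ?thesis
    proof (cases "t \<le> card (U \<inter> H)")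
      case True
      then show ?thesis
        using \<open>v \<in> H\<close> unfolding uncapped_def charge_def gains_def i c by simp
    next
      case False
      then have "charge t H (insert v U) = charge t H U + 1"
        unfolding charge_def i c by simp
      then show ?thesis
        using False step[of "charge t H U"] unfolding uncapped_def gains_def i c by simp
    qed
  next
    case False
    have i: "insert v U - H = insert v (U - H)" "insert v U \<inter> H = U \<inter> H" using False by auto
    have c: "card (insert v (U - H)) = card (U - H) + 1" using assms by simp
    have "charge t H (insert v U) = charge t H U + 1"
      unfolding charge_def i c by simp
    then show ?thesis
      using False step[of "charge t H U"] unfolding uncapped_def gains_def i by simp
  qed
qed

lemma uncapped_mono:
  assumes "S \<subseteq> T" "finite T"
  shows "uncapped d t H S \<le> uncapped d t H T"
proof -
  have "card (S - H) \<le> card (T - H)" "card (S \<inter> H) \<le> card (T \<inter> H)"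
    using assms by (auto intro!: card_mono)
  then show ?thesis
    unfolding uncapped_def charge_def by (intro add_mono div_le_mono) auto
qed

lemma set_function_planted: "set_function m (planted d k t H)"
  unfolding set_function_def
proof (intro conjI allI impI)
  show "planted d k t H {} = 0" by (simp add: planted_def uncapped_def charge_def)
next
  fix S assume "S \<subseteq> {1..m}"
  show "0 \<le> planted d k t H S" by (simp add: planted_def)
next
  fix S T assume "S \<subseteq> T \<and> T \<subseteq> {1..m}"
  then have "uncapped d t H S \<le> uncapped d t H T"
    by (intro uncapped_mono) (auto intro: finite_subset)
  then show "planted d k t H S \<le> planted d k t H T"
    unfolding planted_def by auto
qed

section \<open>Supermodular width of planted functions\<close>

lemma marginal_planted:
  assumes "finite U" "v \<notin> U"
  shows "marginal (planted d k t H) v U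
    = (if gains d t H v U \<and> uncapped d t H U < k then 1 else 0)"
  using uncapped_insert[OF assms, of d t H] by (auto simp: marginal_def planted_def)

text \<open>Why the width is at most \<open>d\<close>: either dropping one element preserves the
  gain, or all of \<open>T\<close> is charged and its \<open>d + 1\<close> elements suffice to reach
  or restore the residue \<open>d\<close> of \<open>charge\<close>.\<close>

lemma ex_smaller_gain:
  assumes "finite S" "finite T" "S \<inter> T = {}" "d < card T" "gains d t H v (S \<union> T)"
  shows "\<exists>T' \<subset> T. gains d t H v (S \<union> T')"
proof -
  let ?U = "S \<union> T"
  have nonempty: "T \<noteq> {}" using assms(4) by auto
  show ?thesis
  proof (cases "v \<in> H \<and> t \<le> card (?U \<inter> H)")
    case v: True
    show ?thesis
    proof (cases "\<exists>x \<in> T. t \<le> card ((?U - {x}) \<inter> H)")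
      case True
      then obtain x where x: "x \<in> T" "t \<le> card ((?U - {x}) \<inter> H)" by blast
      have "S \<union> (T - {x}) = ?U - {x}" using x assms(3) by auto
      then show ?thesis using x v by (intro exI[of _ "T - {x}"]) (auto simp: gains_def)
    next
      \<comment> \<open>Every removal falls below \<open>t\<close>, so \<open>T\<close> lies in
        \<open>H\<close> and \<open>S \<union> T\<close> has exactly \<open>t\<close> hidden
        elements.\<close>
      case False
      have "T \<subseteq> H"
      proof
        fix x assume x: "x \<in> T"
        show "x \<in> H"
        proof (rule ccontr)
          assume "x \<notin> H"
          then have "(?U - {x}) \<inter> H = ?U \<inter> H" by auto
          then show False using False v x by auto
        qed
      qed
      obtain x where x: "x \<in> T" using nonempty by blast
      have "(?U - {x}) \<inter> H = ?U \<inter> H - {x}" by auto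
      moreover have "x \<in> ?U \<inter> H" using x \<open>T \<subseteq> H\<close> by auto
      ultimately have "card ((?U - {x}) \<inter> H) + 1 = card (?U \<inter> H)"
        using assms(1,2) by (metis Suc_eq_plus1 card_Suc_Diff1 finite_Int finite_UnI)
      then have tight: "card (?U \<inter> H) = t" using False v x by fastforce
      have "?U \<inter> H = (S \<inter> H) \<union> T" using \<open>T \<subseteq> H\<close> by auto
      then have cT: "card (S \<inter> H) + card T = t"
        using tight assms(1-3) by (metis card_Un_disjoint finite_Int inf_assoc inf_commute inf_bot_right)
      \<comment> \<open>With all of \<open>T\<close> charged, adding \<open>j\<close> of its
        elements to \<open>S\<close> gives charge \<open>n + j\<close>. The \<open>j\<close> that
        produces residue \<open>d\<close> is at most \<open>d\<close>, and \<open>d < card T\<close>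
        keeps the subset proper.\<close>
      define n where "n = card (S - H) + card (S \<inter> H)"
      define j where "j = d - n mod (d + 1)"
      have "n mod (d + 1) \<le> d" using mod_less_divisor[of "d + 1" n] by linarith
      then have "n mod (d + 1) + j = d" by (simp add: j_def)
      then have jn: "(n + j) mod (d + 1) = d"
        by (metis less_add_one mod_add_left_eq mod_less)
      have "j < card T" using assms(4) by (simp add: j_def)
      then obtain T' where T': "T' \<subseteq> T" "card T' = j"
        by (meson less_imp_le obtain_subset_with_card_n)
      have i: "(S \<union> T') - H = S - H" "(S \<union> T') \<inter> H = (S \<inter> H) \<union> T'"
        using T' \<open>T \<subseteq> H\<close> by auto
      have "card ((S \<inter> H) \<union> T') = card (S \<inter> H) + j"
        using T' assms(1-3) by (subst card_Un_disjoint) (auto intro: finite_subset)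
      then have "charge t H (S \<union> T') = n + j"
        using cT \<open>j < card T\<close> by (simp add: charge_def i n_def)
      then have "gains d t H v (S \<union> T')" using jn by (simp add: gains_def)
      moreover have "T' \<subset> T" using T' \<open>j < card T\<close> by auto
      ultimately show ?thesis by blast
    qed
  next
    case False
    then have md: "charge t H ?U mod (d + 1) = d" using assms(5) by (auto simp: gains_def)
    have fin: "finite ?U" using assms by auto
    show ?thesis
    proof (cases "T \<inter> H \<noteq> {} \<and> t < card (?U \<inter> H)")
      case True
      \<comment> \<open>At least \<open>t\<close> hidden elements remain without \<open>x\<close>,
        so removing it leaves \<open>charge\<close> unchanged.\<close>
      then obtain x where x: "x \<in> T" "x \<in> H" by blast
      have e: "S \<union> (T - {x}) = ?U - {x}" using x assms(3) by auto
      have i: "(?U - {x}) \<inter> H = ?U \<inter> H - {x}" "?U - {x} - H = ?U - H" using x by auto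
      have "card (?U \<inter> H - {x}) = card (?U \<inter> H) - 1" using x fin by simp
      then have "charge t H (?U - {x}) = charge t H ?U"
        using True unfolding charge_def i by linarith
      then have "gains d t H v (S \<union> (T - {x}))" unfolding gains_def e using md by simp
      moreover have "T - {x} \<subset> T" using x by auto
      ultimately show ?thesis by blast
    next
      case False
      \<comment> \<open>Every element of \<open>T\<close> is charged in this case, so removing any
        \<open>d + 1\<close> of them lowers \<open>charge\<close> by \<open>d + 1\<close> and keeps
        its residue.\<close>
      obtain X where X: "X \<subseteq> T" "card X = d + 1"
        using assms(4) by (metis Suc_eq_plus1 Suc_leI obtain_subset_with_card_n)
      have fX: "finite X" using X assms(2) finite_subset by blast
      have e: "S \<union> (T - X) = ?U - X" using X assms(3) by auto
      have c1: "card (?U - H) = card (?U - X - H) + card (X - H)"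
      proof -
        have "?U - H = (?U - X - H) \<union> (X - H)" using X by auto
        also have "card \<dots> = card (?U - X - H) + card (X - H)"
          using fX fin by (intro card_Un_disjoint) auto
        finally show ?thesis .
      qed
      have c2: "card (?U \<inter> H) = card ((?U - X) \<inter> H) + card (X \<inter> H)"
      proof -
        have "?U \<inter> H = ((?U - X) \<inter> H) \<union> (X \<inter> H)" using X by auto
        also have "card \<dots> = card ((?U - X) \<inter> H) + card (X \<inter> H)"
          using fX fin by (intro card_Un_disjoint) auto
        finally show ?thesis .
      qed
      have c3: "card (X - H) + card (X \<inter> H) = d + 1"
        using X(2) fX by (metis add.commute card_Int_Diff)
      have "charge t H ?U = charge t H (?U - X) + (d + 1)"
      proof (cases "T \<inter> H = {}")
        case True
        then have "X \<inter> H = {}" using X by auto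
        then show ?thesis using c1 c2 c3 by (simp add: charge_def)
      next
        case False
        then have "card (?U \<inter> H) \<le> t" using \<open>\<not> (T \<inter> H \<noteq> {} \<and> t < card (?U \<inter> H))\<close> by auto
        then show ?thesis using c1 c2 c3 by (simp add: charge_def)
      qed
      then have "charge t H (?U - X) mod (d + 1) = d" using md by (simp only: mod_add_self2)
      then have "gains d t H v (S \<union> (T - X))" unfolding gains_def e by simp
      moreover have "T - X \<subset> T"
      proof -
        have "X \<noteq> {}" using X(2) by auto
        then show ?thesis using X(1) by blast
      qed
      ultimately show ?thesis by blast
    qed
  qed
qed

text \<open>Marginals are 0 or 1, so a strict increase makes the marginal 1 at
  \<open>S \<union> T\<close> and 0 at \<open>S \<union> T'\<close> for every proper subset
  \<open>T'\<close>. For \<open>d < card T\<close> this contradicts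
  \<open>ex_smaller_gain\<close>.\<close>

lemma supermodular_set_planted_card_le:
  assumes "supermodular_set m (planted d k t H) T"
  shows "card T \<le> d"
proof (rule ccontr)
  assume "\<not> card T \<le> d"
  then have card: "d < card T" by simp
  let ?f = "planted d k t H"
  from assms obtain S v where T: "T \<subseteq> {1..m}" and S: "S \<subseteq> {1..m}" and v: "v \<notin> T"
    and gt: "marginal ?f v (S \<union> T) > Max {marginal ?f v (S \<union> T') |T'. T' \<subset> T}"
    unfolding supermodular_set_def by blast
  have fin: "finite S" "finite T" using S T by (auto intro: finite_subset)
  have "finite {T'. T' \<subset> T}" using fin by (auto intro: finite_subset[of _ "Pow T"])
  then have "finite {marginal ?f v (S \<union> T') |T'. T' \<subset> T}" by (simp add: setcompr_eq_image)
  then have lt: "marginal ?f v (S \<union> T') < marginal ?f v (S \<union> T)" if "T' \<subset> T" for T'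
    using that by (intro le_less_trans[OF Max_ge gt]) auto
  have disj: "S \<inter> T = {}"
  proof (rule ccontr)
    assume "S \<inter> T \<noteq> {}"
    then obtain x where "x \<in> S" "x \<in> T" by blast
    then have "T - {x} \<subset> T" "S \<union> (T - {x}) = S \<union> T" by auto
    then show False using lt[of "T - {x}"] by simp
  qed
  have "{} \<subset> T" using card by auto
  note lt0 = lt[OF this]
  have "v \<notin> S"
  proof
    assume "v \<in> S"
    then have "marginal ?f v (S \<union> X) = 0" for X by (simp add: marginal_def insert_absorb)
    then show False using lt0 by (metis less_irrefl)
  qed
  then have marg: "marginal ?f v (S \<union> T')
      = (if gains d t H v (S \<union> T') \<and> uncapped d t H (S \<union> T') < k then 1 else 0)" if "T' \<subseteq> T" for T'
    using that v fin by (intro marginal_planted) (auto intro: finite_subset)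
  have "gains d t H v (S \<union> T)" and small: "uncapped d t H (S \<union> T) < k"
    using lt0 marg[of T] marg[of "{}"] by (auto split: if_splits)
  then obtain T' where T': "T' \<subset> T" "gains d t H v (S \<union> T')"
    using ex_smaller_gain[OF fin disj card] by blast
  \<comment> \<open>By monotonicity the smaller set is below the cap as well, so its gain is not cut
    off.\<close>
  have "uncapped d t H (S \<union> T') \<le> uncapped d t H (S \<union> T)"
    using T' fin by (intro uncapped_mono) auto
  then have "marginal ?f v (S \<union> T') = 1" using T' small marg[of T'] by auto
  then show False using lt[OF T'(1)] marg[of T] by (auto split: if_splits)
qed

text \<open>The bound is attained by \<open>T = {1..d}\<close>, \<open>S = {}\<close>,
  \<open>v = d + 1\<close>: as \<open>d < t\<close>, all these elements are charged, and
  \<open>v\<close> completes a block only on top of the whole of \<open>T\<close>.\<close>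

lemma SMW_planted:
  assumes "d < t" "0 < k" "d < m"
  shows "SMW m (planted d k t H) = d"
proof -
  let ?f = "planted d k t H"
  let ?I = "insert 0 (card ` {T. T \<noteq> {} \<and> supermodular_set m ?f T})"
  have "?I \<subseteq> {..d}" using supermodular_set_planted_card_le by auto
  moreover have "d \<in> ?I"
  proof (cases "d = 0")
    case False
    have small: "charge t H X = card X" if "X \<subseteq> {1..d}" for X
    proof -
      have fX: "finite X" using that finite_subset by blast
      have "card X \<le> d" using that card_mono[of "{1..d}" X] by simp
      moreover have "card (X \<inter> H) \<le> card X" using fX by (intro card_mono) auto
      ultimately have "card (X \<inter> H) \<le> t" using assms by simp
      then show ?thesis using card_Int_Diff[OF fX, of H] by (simp add: charge_def)
    qed
    have marg: "marginal ?f (d + 1) X = (if card X = d then 1 else 0)" if "X \<subseteq> {1..d}" for X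
    proof -
      have fX: "finite X" using that finite_subset by blast
      have "d + 1 \<notin> X" using that by auto
      have cX: "card X \<le> d" using that card_mono[of "{1..d}" X] by simp
      have "card (X \<inter> H) \<le> card X" using fX by (intro card_mono) auto
      then have "card (X \<inter> H) < t" using assms cX by simp
      then have "gains d t H (d + 1) X \<longleftrightarrow> card X = d" "uncapped d t H X = 0"
        using cX by (auto simp: gains_def uncapped_def small[OF that])
      then show ?thesis using assms marginal_planted[OF fX \<open>d + 1 \<notin> X\<close>, of d k t H] by simp
    qed
    have "{1..d} \<noteq> {}" using False by auto
    moreover have "supermodular_set m ?f {1..d}"
      unfolding supermodular_set_def
    proof (intro conjI exI)
      show "{1..d} \<subseteq> {1..m}" "({} :: nat set) \<subseteq> {1..m}" "d + 1 \<in> {1..m} - {1..d}"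
        using assms by auto
      have "marginal ?f (d + 1) ({} \<union> T') = 0" if "T' \<subset> {1..d}" for T'
        using that psubset_card_mono[OF _ that] marg[of T'] by auto
      moreover have "{} \<subset> {1..d}" using \<open>{1..d} \<noteq> {}\<close> by auto
      ultimately have "{marginal ?f (d + 1) ({} \<union> T') |T'. T' \<subset> {1..d}} = {0}"
        by (intro subset_antisym subsetI) (auto intro!: exI[of _ "{}"])
      then show "marginal ?f (d + 1) ({} \<union> {1..d})
          > Max {marginal ?f (d + 1) ({} \<union> T') |T'. T' \<subset> {1..d}}"
        using marg[of "{1..d}"] by simp
    qed
    ultimately show ?thesis by (auto intro!: rev_image_eqI[of "{1..d}"])
  \<comment> \<open>For \<open>d = 0\<close> the value comes from the 0 inserted in
    \<open>SMW\<close>.\<close>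
  qed simp
  ultimately show ?thesis unfolding SMW_def by (intro Max_eqI) (blast intro: finite_subset)+
qed

section \<open>Telling a planted function from the unplanted one\<close>

lemma planted_empty: "planted d k t {} S = real (min k (card S div (d + 1)))"
  by (simp add: planted_def uncapped_def charge_def)

text \<open>With at most \<open>t\<close> hidden elements everything is charged; with at least
  \<open>(d + 1) * k\<close> elements both functions are at the cap.\<close>

lemma planted_neq_empty:
  assumes "finite S" "planted d k t H S \<noteq> planted d k t {} S"
  shows "t < card (S \<inter> H)" "card S < (d + 1) * k"
proof -
  have c: "card S = card (S \<inter> H) + card (S - H)" using assms(1) by (rule card_Int_Diff)
  show t: "t < card (S \<inter> H)"
  proof (rule ccontr)
    assume "\<not> t < card (S \<inter> H)"
    then show False using assms(2) c
      by (simp add: planted_empty planted_def uncapped_def charge_def add.commute)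
  qed
  show "card S < (d + 1) * k"
  proof (rule ccontr)
    assume "\<not> card S < (d + 1) * k"
    then have k: "k \<le> card S div (d + 1)" by (simp add: less_eq_div_iff_mult_less_eq mult.commute)
    define r where "r = card (S \<inter> H) - t"
    \<comment> \<open>Each of the \<open>r\<close> uncharged elements is worth a whole block of
      \<open>d + 1\<close> charged ones.\<close>
    have "card S = charge t H S + r" using t c by (simp add: charge_def r_def)
    also have "\<dots> \<le> charge t H S + r * (d + 1)" by simp
    finally have "card S div (d + 1) \<le> (charge t H S + r * (d + 1)) div (d + 1)"
      by (rule div_le_mono)
    also have "\<dots> = uncapped d t H S" unfolding uncapped_def r_def
      by (metis add.commute div_mult_self1 add_is_0 one_neq_zero)
    finally have "planted d k t H S = real k" using k by (simp add: planted_def)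
    moreover have "planted d k t {} S = real k" using k by (simp add: planted_empty)
    ultimately show False using assms(2) by simp
  qed
qed

text \<open>Makes the output itself a distinguishing set: where the functions agree, a feasible
  \<open>S\<close> has value at most \<open>k / (d + 1)\<close>, while \<open>H\<close> has value at
  least \<open>k - t\<close>.\<close>

lemma approximates_planted_neq_empty:
  assumes "H \<subseteq> {1..m}" "card H = k" "0 \<le> \<alpha>" "real k / (real d + 1) < \<alpha> * real (k - t)"
    and "approximates m k \<alpha> (planted d k t H) S"
  shows "planted d k t H S \<noteq> planted d k t {} S"
proof
  assume eq: "planted d k t H S = planted d k t {} S"
  have S: "card S \<le> k" using assms(5) by (simp add: approximates_def feasible_def)
  have "real (card S div (d + 1)) \<le> real (card S) / real (d + 1)" by (rule of_nat_div_le_of_nat)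
  also have "\<dots> \<le> real k / (real d + 1)"
    using S by (simp add: divide_right_mono add.commute)
  finally have "planted d k t H S \<le> real k / (real d + 1)"
    unfolding eq planted_empty by (simp add: min_le_iff_disj)
  also note assms(4)
  also have "\<alpha> * real (k - t) \<le> \<alpha> * planted d k t H H"
  proof (rule mult_left_mono)
    show "real (k - t) \<le> planted d k t H H"
      using assms(2) by (simp add: planted_def uncapped_def)
  qed fact
  also have "\<dots> \<le> \<alpha> * Max {planted d k t H S' |S'. feasible m k S'}"
  proof (intro mult_left_mono Max_ge)
    have "finite {S'. feasible m k S'}"
      by (rule finite_subset[of _ "Pow {1..m}"]) (auto simp: feasible_def)
    then show "finite {planted d k t H S' |S'. feasible m k S'}" by (simp add: setcompr_eq_image)
    show "planted d k t H H \<in> {planted d k t H S' |S'. feasible m k S'}"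
      using assms(1,2) by (auto simp: feasible_def)
  qed fact
  finally show False using assms(5) by (simp add: approximates_def)
qed

section \<open>Counting planted sets\<close>

text \<open>Each such \<open>H\<close> arises from a \<open>t\<close>-subset of \<open>S\<close> by
  adding \<open>k - t\<close> further elements of \<open>V\<close>; counting an \<open>H\<close>
  several times is harmless for an upper bound.\<close>

lemma card_heavy_intersection_le:
  assumes "finite V" "S \<subseteq> V"
  shows "card {H. H \<subseteq> V \<and> card H = k \<and> t \<le> card (S \<inter> H)}
    \<le> (card S choose t) * ((card V - t) choose (k - t))"
proof -
  let ?B = "{X. X \<subseteq> S \<and> card X = t}"
  let ?C = "\<lambda>X. {Y. Y \<subseteq> V - X \<and> card Y = k - t}"
  have fS: "finite S" using assms finite_subset by blast
  have fB: "finite ?B" using fS by simp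
  have fV: "finite (?C X)" for X using assms(1) by simp
  have fX: "finite X" if "X \<in> ?B" for X using that fS finite_subset by blast
  have "{H. H \<subseteq> V \<and> card H = k \<and> t \<le> card (S \<inter> H)} \<subseteq> (\<Union>X \<in> ?B. (\<lambda>Y. X \<union> Y) ` ?C X)"
  proof
    fix H assume H: "H \<in> {H. H \<subseteq> V \<and> card H = k \<and> t \<le> card (S \<inter> H)}"
    then obtain X where X: "X \<subseteq> S \<inter> H" "card X = t" by (metis (lifting) mem_Collect_eq obtain_subset_with_card_n)
    then have "H = X \<union> (H - X)" "H - X \<subseteq> V - X" using H by auto
    moreover have "card (H - X) = k - t"
      using X H fX[of X] by (subst card_Diff_subset) auto
    ultimately show "H \<in> (\<Union>X \<in> ?B. (\<lambda>Y. X \<union> Y) ` ?C X)" using X by blast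
  qed
  then have "card {H. H \<subseteq> V \<and> card H = k \<and> t \<le> card (S \<inter> H)}
      \<le> card (\<Union>X \<in> ?B. (\<lambda>Y. X \<union> Y) ` ?C X)"
    using fB fV by (intro card_mono) auto
  also have "\<dots> \<le> (\<Sum>X \<in> ?B. card ((\<lambda>Y. X \<union> Y) ` ?C X))"
    using fB by (rule card_UN_le)
  also have "\<dots> \<le> (\<Sum>X \<in> ?B. (card V - t) choose (k - t))"
  proof (rule sum_mono)
    fix X assume X: "X \<in> ?B"
    have "card ((\<lambda>Y. X \<union> Y) ` ?C X) \<le> card (?C X)" using fV by (rule card_image_le)
    also have "\<dots> = card (V - X) choose (k - t)" using assms(1) by (intro n_subsets) auto
    also have "card (V - X) = card V - t"
      using X fX[OF X] assms(2) by (subst card_Diff_subset) auto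
    finally show "card ((\<lambda>Y. X \<union> Y) ` ?C X) \<le> (card V - t) choose (k - t)" .
  qed
  also have "\<dots> = (card S choose t) * ((card V - t) choose (k - t))"
    using n_subsets[OF fS, of t] by simp
  finally show ?thesis .
qed

text \<open>The power of 2 bounds \<open>card S choose t\<close> and \<open>k choose t\<close>. It
  may be crude because \<open>t\<close> will be a constant fraction of \<open>k\<close>, so that a
  large constant ratio \<open>m / k\<close> outweighs it.\<close>

lemma heavy_intersection_fraction:
  assumes "finite V" "S \<subseteq> V" "0 < t" "t \<le> k" "k \<le> card V" "card S \<le> s"
  shows "real (card {H. H \<subseteq> V \<and> card H = k \<and> t \<le> card (S \<inter> H)})
    \<le> 2 ^ (s + k) * (real k / real (card V)) ^ t * real (card V choose k)"
proof -
  let ?m = "card V"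
  have "real (card S choose t) \<le> 2 ^ card S" 
    by (metis binomial_le_pow2 of_nat_le_iff of_nat_numeral of_nat_power)
  also have "\<dots> \<le> 2 ^ s" using assms(6) by simp
  finally have b1: "real (card S choose t) \<le> 2 ^ s" .
  have b2: "real (k choose t) \<le> 2 ^ k"
    by (metis binomial_le_pow2 of_nat_le_iff of_nat_numeral of_nat_power)
  have pos: "0 < real ?m" "0 < real k" "0 < real t" using assms by auto
  have b3: "(real ?m / real k) ^ t \<le> real (?m choose t)"
  proof -
    have "(real ?m / real k) ^ t \<le> (real ?m / real t) ^ t"
      using pos assms(4) by (intro power_mono divide_left_mono) auto
    also have "\<dots> \<le> real (?m choose t)"
      using assms binomial_ge_n_over_k_pow_k[of t ?m, where 'a = real] by simp
    finally show ?thesis .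
  qed
  \<comment> \<open>Pairs of a \<open>k\<close>-set and a \<open>t\<close>-subset of it are counted
    in two ways.\<close>
  have "real ((?m - t) choose (k - t)) = real (?m choose k) * real (k choose t) / real (?m choose t)"
  proof -
    have "(?m choose k) * (k choose t) = (?m choose t) * ((?m - t) choose (k - t))"
      using assms by (intro choose_mult) auto
    then have "real (?m choose k) * real (k choose t) = real (?m choose t) * real ((?m - t) choose (k - t))"
      by (simp only: of_nat_mult[symmetric])
    moreover have "?m choose t > 0" using assms by simp
    ultimately show ?thesis by simp
  qed
  also have "\<dots> \<le> real (?m choose k) * 2 ^ k / (real ?m / real k) ^ t"
    using b2 b3 pos by (intro frac_le mult_left_mono mult_nonneg_nonneg) auto
  also have "\<dots> = 2 ^ k * (real k / real ?m) ^ t * real (?m choose k)"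
    by (simp add: power_divide)
  finally have b4: "real ((?m - t) choose (k - t)) \<le> 2 ^ k * (real k / real ?m) ^ t * real (?m choose k)" .
  have "real (card {H. H \<subseteq> V \<and> card H = k \<and> t \<le> card (S \<inter> H)})
      \<le> real (card S choose t) * real ((?m - t) choose (k - t))"
    unfolding of_nat_mult[symmetric] by (intro of_nat_mono card_heavy_intersection_le assms)
  also have "\<dots> \<le> 2 ^ s * (2 ^ k * (real k / real ?m) ^ t * real (?m choose k))"
    using b1 b4 by (intro mult_mono) auto
  finally show ?thesis by (simp add: power_add mult.assoc)
qed

section \<open>Indistinguishability\<close>

text \<open>The output counts as a probe too, and is repeated for ever after the algorithm has halted.\<close>

definition probe :: "algorithm \<Rightarrow> (nat set \<Rightarrow> real) \<Rightarrow> nat \<Rightarrow> nat set" where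
  "probe A f n = (case A (answers A f n) of Query S \<Rightarrow> S | Output S \<Rightarrow> S)"

lemma probe_subset: "algorithm_on m A \<Longrightarrow> probe A f n \<subseteq> {1..m}"
  by (auto simp: probe_def algorithm_on_def split: action.split)

lemma answers_cong:
  assumes "\<And>i. i < n \<Longrightarrow> g (probe A f i) = f (probe A f i)"
  shows "answers A g n = answers A f n"
  using assms
proof (induction n)
  case (Suc n)
  then have "answers A g n = answers A f n" by simp
  moreover have "g (probe A f n) = f (probe A f n)" using Suc.prems by simp
  ultimately show ?case by (cases "A (answers A f n)") (simp_all add: probe_def)
qed simp

text \<open>If no probe told \<open>f\<close> and \<open>g\<close> apart, both runs would receive
  the same answers, so the approximating output on \<open>g\<close> would be a probe of the run on
  \<open>f\<close>.\<close>

lemma succeeds_imp_distinguishing_probe: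
  assumes "succeeds m k \<alpha> g A" "\<And>S. approximates m k \<alpha> g S \<Longrightarrow> g S \<noteq> f S"
  shows "\<exists>i. g (probe A f i) \<noteq> f (probe A f i)"
proof (rule ccontr)
  assume "\<nexists>i. g (probe A f i) \<noteq> f (probe A f i)"
  then have eq: "g (probe A f i) = f (probe A f i)" for i by simp
  obtain S n where S: "approximates m k \<alpha> g S" "A (answers A g n) = Output S"
    using assms(1) by (auto simp: succeeds_def outputs_def)
  then have "probe A f n = S" using answers_cong[of n g A f] eq by (simp add: probe_def)
  then show False using eq assms(2)[OF S(1)] by metis
qed

lemma num_queries_eq_enat:
  assumes "num_queries A f = enat N"
  shows "\<exists>S. A (answers A f N) = Output S"
proof -
  define I where "I = {enat n |n. \<exists>S. A (answers A f n) = Output S}"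
  have Inf: "Inf I = enat N" using assms by (simp add: num_queries_def I_def)
  then have "I \<noteq> {}" by (auto simp: Inf_enat_def)
  \<comment> \<open>A nonempty set of \<open>enat\<close> has a least element, so the infimum is
    attained.\<close>
  then have "(LEAST x. x \<in> I) \<in> I" using LeastI_ex[of "\<lambda>x. x \<in> I"] by auto
  then have "Inf I \<in> I" using \<open>I \<noteq> {}\<close> by (simp add: Inf_enat_def)
  then show ?thesis using Inf by (auto simp: I_def)
qed

text \<open>\<open>N\<close> queries and the output make \<open>N + 1\<close> probes, which is the
  source of the \<open>+ 1\<close> in the query bounds.\<close>

lemma range_probe_subset:
  assumes "num_queries A f = enat N"
  shows "range (probe A f) \<subseteq> probe A f ` {..N}"
proof -
  obtain S where S: "A (answers A f N) = Output S" using num_queries_eq_enat[OF assms] by blast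
  have "answers A f (N + j) = answers A f N" for j by (induction j) (simp_all add: S)
  then have "probe A f (N + j) = probe A f N" for j by (simp add: probe_def)
  then have "probe A f n \<in> probe A f ` {..N}" for n
    by (metis atMost_iff image_eqI le_add_diff_inverse le_refl linorder_le_cases)
  then show ?thesis by auto
qed

text \<open>Averaging over \<open>H\<close>: success has probability at least \<open>p\<close> for
  each \<open>H\<close>, whereas a single deterministic algorithm with \<open>N\<close> queries on
  \<open>f\<close> succeeds on at most a fraction \<open>(N + 1) * P\<close> of \<open>F\<close>, by
  a union bound over its probes. Exchanging sum and integral compares the two.\<close>

lemma randomized_query_lower_bound:
  fixes f :: "nat set \<Rightarrow> real" and g :: "'h \<Rightarrow> nat set \<Rightarrow> real"
  assumes alg: "randomized_approximation_algorithm m k d \<alpha> p R"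
    and fam: "finite F" "F \<noteq> {}"
    and f: "set_function m f"
    and g: "\<And>H. H \<in> F \<Longrightarrow> set_function m (g H)" "\<And>H. H \<in> F \<Longrightarrow> SMW m (g H) = d"
    and sep: "\<And>H S. H \<in> F \<Longrightarrow> approximates m k \<alpha> (g H) S \<Longrightarrow> g H S \<noteq> f S"
    and rare: "\<And>S. S \<subseteq> {1..m} \<Longrightarrow> real (card {H \<in> F. g H S \<noteq> f S}) \<le> P * real (card F)"
    and P: "0 < P"
  shows "ennreal p \<le> (expected_queries R f + 1) * ennreal P"
proof -
  have R: "prob_space R" "\<And>A. A \<in> space R \<Longrightarrow> algorithm_on m A"
    "\<And>h S. set_function m h \<Longrightarrow> {A \<in> space R. outputs A h S} \<in> sets R"
    "(\<lambda>A. num_queries A f) \<in> measurable R (count_space UNIV)"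
    and succ: "\<And>H. H \<in> F \<Longrightarrow> p \<le> measure R {A \<in> space R. succeeds m k \<alpha> (g H) A}"
    using alg f g unfolding randomized_approximation_algorithm_def randomized_algorithm_on_def by auto
  interpret prob_space R by fact
  define c where "c = real (card F)"
  have c: "0 < c" using fam by (simp add: c_def card_gt_0_iff)
  let ?E = "\<lambda>H. {A \<in> space R. succeeds m k \<alpha> (g H) A}"
  have meas: "?E H \<in> sets R" if "H \<in> F" for H
  proof -
    \<comment> \<open>Measurability is given for single outputs; only finitely many sets are
      feasible, so a finite union suffices.\<close>
    have "?E H = (\<Union>S \<in> {S. approximates m k \<alpha> (g H) S}. {A \<in> space R. outputs A (g H) S})"
      by (auto simp: succeeds_def)
    moreover have "finite {S. approximates m k \<alpha> (g H) S}"
      by (rule finite_subset[of _ "Pow {1..m}"]) (auto simp: approximates_def feasible_def)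
    ultimately show ?thesis using R(3)[OF g(1)[OF that]] by auto
  qed
  have pointwise: "(\<Sum>H \<in> F. indicator (?E H) A)
      \<le> (ennreal_of_enat (num_queries A f) + 1) * ennreal (P * c)" if A: "A \<in> space R" for A
  proof (cases "num_queries A f")
    case (enat N)
    let ?D = "\<lambda>S. {H \<in> F. g H S \<noteq> f S}"
    have "{H \<in> F. A \<in> ?E H} \<subseteq> (\<Union>i \<in> {..N}. ?D (probe A f i))"
    proof
      fix H assume H: "H \<in> {H \<in> F. A \<in> ?E H}"
      then obtain i where "g H (probe A f i) \<noteq> f (probe A f i)"
        using succeeds_imp_distinguishing_probe[of m k \<alpha> "g H" A f] sep by auto
      moreover obtain j where "j \<le> N" "probe A f i = probe A f j"
        using range_probe_subset[OF enat] by (auto simp: image_subset_iff)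
      ultimately show "H \<in> (\<Union>i \<in> {..N}. ?D (probe A f i))" using H by auto
    qed
    then have "card {H \<in> F. A \<in> ?E H} \<le> card (\<Union>i \<in> {..N}. ?D (probe A f i))"
      using fam by (intro card_mono) auto
    also have "\<dots> \<le> (\<Sum>i \<in> {..N}. card (?D (probe A f i)))" by (intro card_UN_le) simp
    finally have "real (card {H \<in> F. A \<in> ?E H}) \<le> (\<Sum>i \<in> {..N}. real (card (?D (probe A f i))))"
      unfolding of_nat_sum[symmetric] by (rule of_nat_mono)
    also have "\<dots> \<le> (\<Sum>i \<in> {..N}. P * c)"
      unfolding c_def by (intro sum_mono rare probe_subset R(2) A)
    also have "\<dots> = (real N + 1) * (P * c)" by (simp add: add.commute)
    finally have "ennreal (real (card {H \<in> F. A \<in> ?E H})) \<le> ennreal ((real N + 1) * (P * c))"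
      by (rule ennreal_leI)
    also have "\<dots> = ennreal (real N + 1) * ennreal (P * c)" using P c by (intro ennreal_mult) auto
    also have "ennreal (real N + 1) = of_nat N + 1" by (simp add: ennreal_of_nat_eq_real_of_nat)
    finally show ?thesis
      using fam enat by (simp add: indicator_def ennreal_of_nat_eq_real_of_nat sum.If_cases Int_def)
  next
    \<comment> \<open>The right-hand side is infinite because \<open>P * c\<close> is
      positive.\<close>
    case infinity
    then show ?thesis using P c by (simp add: ennreal_mult_top ennreal_top_mult)
  qed
  have "ennreal p * ennreal c = (\<Sum>H \<in> F. ennreal p)"
    by (simp add: c_def ennreal_of_nat_eq_real_of_nat mult.commute)
  also have "\<dots> \<le> (\<Sum>H \<in> F. emeasure R (?E H))"
    by (intro sum_mono) (auto simp: emeasure_eq_measure intro!: ennreal_leI succ)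
  also have "\<dots> = (\<Sum>H \<in> F. \<integral>\<^sup>+ A. indicator (?E H) A \<partial>R)"
    using meas by (intro sum.cong) auto
  also have "\<dots> = (\<integral>\<^sup>+ A. (\<Sum>H \<in> F. indicator (?E H) A) \<partial>R)"
    using meas by (intro nn_integral_sum[symmetric]) auto
  also have "\<dots> \<le> (\<integral>\<^sup>+ A. (ennreal_of_enat (num_queries A f) + 1) * ennreal (P * c) \<partial>R)"
    by (intro nn_integral_mono pointwise)
  also have "\<dots> = (expected_queries R f + 1) * ennreal (P * c)"
  proof -
    have m: "(\<lambda>A. ennreal_of_enat (num_queries A f)) \<in> borel_measurable R"
      by (rule measurable_compose[OF R(4)]) simp
    then show ?thesis
      unfolding expected_queries_def
      by (simp add: nn_integral_multc nn_integral_add emeasure_space_1)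
  qed
  also have "\<dots> = (expected_queries R f + 1) * ennreal P * ennreal c"
    using P c by (simp add: ennreal_mult mult.assoc)
  finally show ?thesis
    using c by (simp add: ennreal_mult_le_mult_iff mult.commute[of _ "ennreal c"])
qed

text \<open>The point mass at \<open>A\<close> on the discrete space \<open>{A}\<close>: every event
  is measurable, and success has probability 1.\<close>

lemma deterministic_as_randomized:
  assumes "approximation_algorithm m k d \<alpha> A" "p \<le> 1"
  shows "\<exists>R. randomized_approximation_algorithm m k d \<alpha> p R
    \<and> (\<forall>f. expected_queries R f = ennreal_of_enat (num_queries A f))"
proof (intro exI conjI allI)
  let ?R = "return (count_space {A}) A"
  interpret prob_space ?R by (rule prob_space_return) simp
  show "expected_queries ?R f = ennreal_of_enat (num_queries A f)" for f
    unfolding expected_queries_def by (subst nn_integral_return) auto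
  have "measure ?R {B \<in> space ?R. succeeds m k \<alpha> g B} = 1" if "set_function m g \<and> SMW m g = d" for g
  proof -
    have "{B \<in> space ?R. succeeds m k \<alpha> g B} = space ?R"
      using assms(1) that by (auto simp: approximation_algorithm_def)
    then show ?thesis using prob_space by metis
  qed
  moreover have "randomized_algorithm_on m ?R"
    using assms(1) prob_space_axioms
    by (auto simp: randomized_algorithm_on_def approximation_algorithm_def measurable_def)
  ultimately show "randomized_approximation_algorithm m k d \<alpha> p ?R"
    using assms(2) by (simp add: randomized_approximation_algorithm_def)
qed

section \<open>The lower bound\<close>

text \<open>The family consists of all \<open>k\<close>-subsets of \<open>{1..m}\<close>. The
  exponent \<open>(d + 2) * k\<close> is the bound \<open>(d + 1) * k\<close> on the size of a
  distinguishing probe plus the \<open>k\<close> from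
  \<open>heavy_intersection_fraction\<close>.\<close>

lemma planted_randomized_lower_bound:
  assumes alg: "randomized_approximation_algorithm m k d \<alpha> p R"
    and "d < t" "t \<le> k" "k \<le> m" "0 \<le> \<alpha>" "real k / (real d + 1) < \<alpha> * real (k - t)"
  shows "ennreal p \<le> (expected_queries R (planted d k t {}) + 1)
    * ennreal (2 ^ ((d + 2) * k) * (real k / real m) ^ t)"
proof (rule randomized_query_lower_bound[OF alg])
  let ?F = "{H. H \<subseteq> {1..m} \<and> card H = k}"
  show "finite ?F" by simp
  have card_F: "card ?F = m choose k" using n_subsets[of "{1..m}" k] by simp
  then show "?F \<noteq> {}" using assms by (metis card.empty binomial_eq_0_iff not_le)
  show "set_function m (planted d k t {})" "set_function m (planted d k t H)" for H
    by (rule set_function_planted)+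
  show "SMW m (planted d k t H) = d" for H using assms by (intro SMW_planted) auto
  show "planted d k t H S \<noteq> planted d k t {} S"
    if "H \<in> ?F" "approximates m k \<alpha> (planted d k t H) S" for H S
    using that assms by (intro approximates_planted_neq_empty) auto
  show "0 < 2 ^ ((d + 2) * k) * (real k / real m) ^ t" using assms by simp
  fix S :: "nat set" assume S: "S \<subseteq> {1..m}"
  then have fS: "finite S" using finite_subset by blast
  let ?D = "{H \<in> ?F. planted d k t H S \<noteq> planted d k t {} S}"
  show "real (card ?D) \<le> 2 ^ ((d + 2) * k) * (real k / real m) ^ t * real (card ?F)"
  proof (cases "card S < (d + 1) * k")
    case True
    have "?D \<subseteq> {H. H \<subseteq> {1..m} \<and> card H = k \<and> t \<le> card (S \<inter> H)}"
      using planted_neq_empty(1)[OF fS] by (fastforce intro: less_imp_le)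
    then have "real (card ?D) \<le> real (card {H. H \<subseteq> {1..m} \<and> card H = k \<and> t \<le> card (S \<inter> H)})"
      by (intro of_nat_mono card_mono) auto
    also have "\<dots> \<le> 2 ^ ((d + 1) * k + k) * (real k / real (card {1..m})) ^ t * real (card {1..m} choose k)"
      using assms S True by (intro heavy_intersection_fraction) auto
    finally show ?thesis unfolding card_F by (simp add: add.commute add.left_commute)
  next
    case False
    then have "?D = {}" using planted_neq_empty(2)[OF fS] by blast
    then show ?thesis by (simp only: card.empty of_nat_0) (intro mult_nonneg_nonneg zero_le_power; simp)
  qed
qed

text \<open>Here \<open>x\<close> stands for \<open>m / k\<close>. Since \<open>t\<close> is at
  least \<open>2 * q\<close> for \<open>q = k / (4 * D)\<close>, \<open>x ^ t\<close> yields two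
  factors \<open>x powr q\<close>: one pays for \<open>2 ^ ((d + 2) * k)\<close>, the other
  dominates the claimed power. Half of \<open>p\<close> absorbs the \<open>- 1\<close>, thanks to
  \<open>4 / p \<le> x\<close>.\<close>

lemma asymptotic_bound:
  fixes x p :: real and D k d t :: nat
  assumes "0 < p" "p \<le> 1" "0 < D" "2 * D \<le> k" "t = k div D"
    and "2 ^ (4 * D * (d + 2)) \<le> x" "4 / p \<le> x" "real k powr 0.99 \<le> real k / (4 * real D)"
  shows "p / 2 * (x / 2) powr (real k powr 0.99)
    \<le> p * (x ^ t / 2 ^ ((d + 2) * k)) - 1"
proof -
  let ?e = "real k powr 0.99"
  have x4: "4 \<le> x" using assms(1,2,7) frac_le[of 4 4 p 1] by simp
  have k1: "1 \<le> real k" using assms(3,4) by linarith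
  have t: "real k / (2 * real D) \<le> real t"
  proof -
    \<comment> \<open>Rounding down costs at most a factor 2, because \<open>k / D\<close> is at
      least 2.\<close>
    have "k < (t + 1) * D" using assms(3,5) by (simp add: dividend_less_div_times add.commute)
    then have "real k < (real t + 1) * real D" by (metis of_nat_1 of_nat_add of_nat_less_iff of_nat_mult)
    then have "real k / real D < real t + 1" using assms(3) by (simp add: divide_less_eq)
    moreover have "2 \<le> real k / real D" using assms(3,4) by (simp add: le_divide_eq)
    ultimately have "real k / real D \<le> 2 * real t" by linarith
    then show ?thesis by (simp add: field_simps)
  qed
  define q where "q = real k / (4 * real D)"
  have "x powr (q + q) \<le> x powr real t" using t x4 by (intro powr_mono) (auto simp: q_def)
  then have xt: "x powr q * x powr q \<le> x ^ t" using x4 by (simp only: powr_add) (simp add: powr_realpow)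
  have "(2::real) ^ ((d + 2) * k) = 2 powr real ((d + 2) * k)" by (rule powr_realpow[symmetric]) simp
  also have "real ((d + 2) * k) = real (4 * D * (d + 2)) * q" using assms(3) by (simp add: q_def field_simps)
  also have "2 powr (real (4 * D * (d + 2)) * q) = (2 ^ (4 * D * (d + 2))) powr q"
    by (simp only: powr_powr[symmetric] powr_realpow zero_less_numeral)
  also have "\<dots> \<le> x powr q" using assms(6) by (intro powr_mono2) (auto simp: q_def)
  finally have "x powr q * 2 ^ ((d + 2) * k) \<le> x powr q * x powr q" by (intro mult_left_mono) auto
  also note xt
  finally have *: "x powr q \<le> x ^ t / 2 ^ ((d + 2) * k)" by (simp add: le_divide_eq)
  have "(x / 2) powr ?e \<le> x powr ?e" using x4 by (intro powr_mono2) auto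
  also have "\<dots> \<le> x powr q" using x4 assms(8) by (intro powr_mono) (auto simp: q_def)
  also note *
  finally have y: "(x / 2) powr ?e \<le> x ^ t / 2 ^ ((d + 2) * k)" .
  have "1 \<le> ?e" using k1 by (intro ge_one_powr_ge_zero) auto
  then have "(x / 2) powr 1 \<le> (x / 2) powr ?e" using x4 by (intro powr_mono) auto
  then have "2 / p \<le> (x / 2) powr ?e" using x4 assms(7) by simp
  then have "1 \<le> p / 2 * (x / 2) powr ?e" using assms(1) by (simp add: field_simps)
  moreover have "p * (x / 2) powr ?e \<le> p * (x ^ t / 2 ^ ((d + 2) * k))"
    using y assms(1) by (intro mult_left_mono) auto
  ultimately show ?thesis by linarith
qed

text \<open>Split \<open>k\<close> as \<open>k powr 0.99 * k powr 0.01\<close>; the 100th power in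
  the threshold makes the second factor at least \<open>4 * D\<close>.\<close>

lemma powr_099_le_fraction:
  fixes D k :: nat
  assumes "0 < D" "(4 * D) ^ 100 \<le> k"
  shows "real k powr 0.99 \<le> real k / (4 * real D)"
proof -
  have "real ((4 * D) ^ 100) \<le> real k" using assms(2) by (rule of_nat_mono)
  then have le: "(4 * real D) ^ 100 \<le> real k" by (simp only: of_nat_power of_nat_mult of_nat_numeral)
  have pos: "0 < 4 * real D" using assms(1) by simp
  then have k: "0 < real k" using le zero_less_power[OF pos, of 100] by linarith
  have "4 * real D = ((4 * real D) powr real 100) powr 0.01"
    using pos by (simp only: powr_powr) simp
  also have "\<dots> = ((4 * real D) ^ 100) powr 0.01" using pos by (simp only: powr_realpow)
  also have "\<dots> \<le> real k powr 0.01" using le pos by (intro powr_mono2 zero_le_power) auto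
  finally have "real k powr 0.99 * (4 * real D) \<le> real k powr 0.99 * real k powr 0.01"
    by (intro mult_left_mono) auto
  also have "\<dots> = real k" using k by (simp add: powr_add[symmetric])
  finally show ?thesis using pos by (simp only: pos_le_divide_eq)
qed

theorem theorem9:
  fixes d :: nat and \<epsilon> p :: real
  assumes "\<epsilon> > 0" and "0 < p" and "p \<le> 1"
  shows "\<exists>c :: real. c > 0 \<and> (\<exists>M K :: nat. \<forall>k m :: nat. k \<ge> K \<and> m \<ge> M * k \<longrightarrow>
    (\<exists>f. set_function m f \<and> SMW m f = d \<and>
      (\<forall>A. approximation_algorithm m k d (1 / (real d + 1) + \<epsilon>) A \<longrightarrow>
         ennreal_of_enat (num_queries A f)
           \<ge> ennreal (c * (real m / (2 * real k)) powr (real k powr 0.99))) \<and>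
      (\<forall>R. randomized_approximation_algorithm m k d (1 / (real d + 1) + \<epsilon>) p R \<longrightarrow>
         expected_queries R f
           \<ge> ennreal (c * (real m / (2 * real k)) powr (real k powr 0.99)))))"
proof -
  define \<alpha> where "\<alpha> = 1 / (real d + 1) + \<epsilon>"
  have \<alpha>: "0 < \<alpha>" using assms by (simp add: \<alpha>_def add_nonneg_pos)
  \<comment> \<open>With \<open>t = k div D\<close>, this choice gives
    \<open>\<alpha> * t < \<epsilon> * k\<close>, so that \<open>\<alpha> * (k - t)\<close> still
    exceeds \<open>k / (d + 1)\<close>.\<close>
  define D where "D = nat \<lceil>\<alpha> / \<epsilon>\<rceil> + 1"
  have D: "0 < D" "\<alpha> / \<epsilon> < real D" unfolding D_def by (simp_all add: less_add_one) linarith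
  \<comment> \<open>A lower bound on \<open>m / k\<close> that meets both conditions on
    \<open>x\<close> in \<open>asymptotic_bound\<close>.\<close>
  define M where "M = nat \<lceil>max (2 ^ (4 * D * (d + 2))) (4 / p)\<rceil>"
  have M: "2 ^ (4 * D * (d + 2)) \<le> real M" "4 / p \<le> real M" unfolding M_def by linarith+
  \<comment> \<open>The first bound serves \<open>powr_099_le_fraction\<close>; the second gives
    \<open>d + 2 \<le> t\<close> and \<open>2 * D \<le> k\<close>.\<close>
  define K where "K = max ((4 * D) ^ 100) ((d + 2) * D)"
  show ?thesis
  proof (rule exI[of _ "p / 2"], rule conjI, use assms in simp, rule exI[of _ M], rule exI[of _ K],
      intro allI impI)
    fix k m :: nat assume km: "K \<le> k \<and> M * k \<le> m"
    define t where "t = k div D"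
    have "(d + 2) * D \<le> k" using km by (simp only: K_def max.bounded_iff)
    moreover have "0 < (d + 2) * D" using D(1) by simp
    ultimately have k: "(d + 2) * D \<le> k" "0 < k" by linarith+
    have "d + 2 \<le> t" unfolding t_def using k D by (simp add: less_eq_div_iff_mult_less_eq)
    moreover have "t \<le> k" by (simp add: t_def)
    moreover have "1 \<le> M" using M(1) by (metis One_nat_def Suc_leI gr0I not_le of_nat_0 zero_less_numeral zero_less_power)
    then have "k \<le> m" using km by (metis le_trans mult_le_mono1 mult_1)
    moreover have "real k / (real d + 1) < \<alpha> * real (k - t)"
    proof -
      have "real t \<le> real k / real D" unfolding t_def by (rule of_nat_div_le_of_nat)
      then have "\<alpha> * real t \<le> \<alpha> * (real k / real D)" using \<alpha> by (intro mult_left_mono) auto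
      also have "\<dots> = \<alpha> / real D * real k" by simp
      also have "\<dots> < \<epsilon> * real k"
        using D assms(1) k by (intro mult_strict_right_mono) (auto simp: field_simps)
      finally have "\<alpha> * real t < \<epsilon> * real k" .
      moreover have "\<alpha> * real (k - t) = real k / (real d + 1) + \<epsilon> * real k - \<alpha> * real t"
        using \<open>t \<le> k\<close> by (simp add: of_nat_diff right_diff_distrib) (simp add: \<alpha>_def distrib_right)
      ultimately show ?thesis by linarith
    qed
    ultimately have prem: "d < t" "t \<le> k" "k \<le> m" "0 \<le> \<alpha>" "real k / (real d + 1) < \<alpha> * real (k - t)"
      using \<alpha> by auto
    \<comment> \<open>The hard function is the unplanted one, fixed before any algorithm; the
      planted ones enter only because the algorithm must succeed on them too.\<close>
    let ?f = "planted d k t {}"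
    let ?Y = "p / 2 * (real m / (2 * real k)) powr (real k powr 0.99)"
    have x: "real M \<le> real m / real k"
      using km k by (metis le_divide_eq of_nat_0_less_iff of_nat_le_iff of_nat_mult)
    have Y: "?Y \<le> p * ((real m / real k) ^ t / 2 ^ ((d + 2) * k)) - 1"
    proof -
      have "2 * D \<le> k" using k(1) by (meson le_add2 le_trans mult_le_mono1)
      moreover have "real k powr 0.99 \<le> real k / (4 * real D)" using powr_099_le_fraction[OF D(1)] km by (simp only: K_def max.bounded_iff)
      ultimately have "p / 2 * (real m / real k / 2) powr (real k powr 0.99)
          \<le> p * ((real m / real k) ^ t / 2 ^ ((d + 2) * k)) - 1"
        using assms(2,3) D(1) t_def order_trans[OF M(1) x] order_trans[OF M(2) x]
        by (intro asymptotic_bound)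
      then show ?thesis by (simp only: divide_divide_eq_left mult.commute)
    qed
    have main: "ennreal ?Y \<le> expected_queries R ?f"
      if R: "randomized_approximation_algorithm m k d \<alpha> p R" for R
    proof (cases "expected_queries R ?f")
      case (real e)
      let ?P = "2 ^ ((d + 2) * k) * (real k / real m) ^ t"
      have P: "0 < ?P" using prem k by simp
      have "ennreal p \<le> (ennreal e + 1) * ennreal ?P"
        using planted_randomized_lower_bound[OF R prem] real by simp
      also have "\<dots> = ennreal ((e + 1) * ?P)"
        using real P by (subst ennreal_mult) auto
      finally have "p \<le> (e + 1) * ?P" using real P by (subst (asm) ennreal_le_iff) auto
      then have "p / ?P \<le> e + 1" using P by (simp add: divide_le_eq)
      moreover have "p / ?P = p * ((real m / real k) ^ t / 2 ^ ((d + 2) * k))"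
        by (simp add: power_divide)
      ultimately have "?Y \<le> e" using Y by linarith
      then show ?thesis using real by (simp add: ennreal_leI)
    qed simp
    show "\<exists>f. set_function m f \<and> SMW m f = d \<and>
      (\<forall>A. approximation_algorithm m k d (1 / (real d + 1) + \<epsilon>) A \<longrightarrow>
         ennreal_of_enat (num_queries A f) \<ge> ennreal ?Y) \<and>
      (\<forall>R. randomized_approximation_algorithm m k d (1 / (real d + 1) + \<epsilon>) p R \<longrightarrow>
         expected_queries R f \<ge> ennreal ?Y)"
    proof (intro exI[of _ ?f] conjI allI impI)
      show "set_function m ?f" by (rule set_function_planted)
      show "SMW m ?f = d" using prem k by (intro SMW_planted) auto
    next
      fix A assume "approximation_algorithm m k d (1 / (real d + 1) + \<epsilon>) A"
      then show "ennreal ?Y \<le> ennreal_of_enat (num_queries A ?f)"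
        using deterministic_as_randomized[OF _ assms(3)] main unfolding \<alpha>_def by metis
    next
      fix R assume "randomized_approximation_algorithm m k d (1 / (real d + 1) + \<epsilon>) p R"
      then show "ennreal ?Y \<le> expected_queries R ?f" using main unfolding \<alpha>_def by blast
    qed
  qed
qed

end
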